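(* There is a deterministic algorithm which, on input a positive integer $k$, outputs a $2$-coloring of $\{1,\ldots,n\}$ with no monochromatic $k$-AP, where $n$ is the largest integer with $n<\sqrt{k}\,2^{(k-1)/2}$, and runs in time polynomial in $\sqrt{k}\,2^{(k-1)/2}$. In particular $W(k,2)\ge \sqrt{k}\,2^{(k-1)/2}$.
   Context: A $k$-AP is a set $\{a,a+d,\ldots,a+(k-1)d\}$ with $a,d$ positive integers. A $2$-coloring of $\{1,\ldots,n\}$ is proper if no $k$-AP contained in $\{1,\ldots,n\}$ is monochromatic. $W(k,2)$ is the least $W$ such that every $2$-coloring of $\{1,\ldots,W\}$ contains a monochromatic $k$-AP. (The paper calls such a proof "deterministic-constructive".) *)

theory Defs
  imports
    "HOL-Library.Extended_Real"
    "HOL-Library.FuncSet"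
    "HOL-Computational_Algebra.Polynomial"
begin

definition is_AP :: "nat \<Rightarrow> nat set \<Rightarrow> bool" where
  "is_AP k A \<longleftrightarrow> (\<exists>a d. a > 0 \<and> d > 0 \<and> A = {a + i * d | i. i < k})"

definition two_colorings :: "nat \<Rightarrow> (nat \<Rightarrow> nat) set" where
  "two_colorings n = {1..n} \<rightarrow> {0, 1}"

definition monochromatic :: "(nat \<Rightarrow> nat) \<Rightarrow> nat set \<Rightarrow> bool" where
  "monochromatic f A \<longleftrightarrow> (\<exists>c. \<forall>x\<in>A. f x = c)"

definition proper_coloring :: "nat \<Rightarrow> nat \<Rightarrow> (nat \<Rightarrow> nat) \<Rightarrow> bool" where
  "proper_coloring k n f \<longleftrightarrow>
     f \<in> two_colorings n \<and> \<not> (\<exists>A. is_AP k A \<and> A \<subseteq> {1..n} \<and> monochromatic f A)"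

text \<open>The van der Waerden number \<open>W(k,2)\<close>. The least element is taken in \<^typ>\<open>enat\<close>, so that
  the definition does not presuppose van der Waerden's theorem (an infimum of a nonempty set of
  extended naturals is its least element).\<close>

definition vdW :: "nat \<Rightarrow> enat" where
  "vdW k = Inf (enat ` {W. \<forall>f\<in>two_colorings W.
                            \<exists>A. is_AP k A \<and> A \<subseteq> {1..W} \<and> monochromatic f A})"

definition vdW_bound :: "nat \<Rightarrow> real" where
  "vdW_bound k = sqrt (real k) * 2 powr ((real k - 1) / 2)"

text \<open>Natural numbers suffice here: the bound is positive for \<open>k > 0\<close>, so the largest integer
  below it is nonnegative.\<close>

definition coloring_length :: "nat \<Rightarrow> nat" where
  "coloring_length k = (GREATEST n. real n < vdW_bound k)"

text \<open>Algorithms are programs of a deterministic random access machine in the style of Cook and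
  Reckhow, with natural numbers in registers \<open>X\<^sub>0, X\<^sub>1, \<dots>\<close>, indirect addressing, and time measured
  as the number of executed instructions. There is no multiplication, so (apart from the constants of the program) each instruction lengthens
  the longest number stored by at most one bit, and unit-cost time is polynomially related to Turing
  machine time. Subtraction is truncated at \<open>0\<close>.\<close>

datatype instr =
    Const nat nat      \<comment> \<open>\<open>Const i c\<close>: \<open>X\<^sub>i := c\<close>\<close>
  | Add nat nat nat    \<comment> \<open>\<open>Add i j l\<close>: \<open>X\<^sub>i := X\<^sub>j + X\<^sub>l\<close>\<close>
  | Sub nat nat nat    \<comment> \<open>\<open>Sub i j l\<close>: \<open>X\<^sub>i := X\<^sub>j - X\<^sub>l\<close>\<close>
  | Load nat nat       \<comment> \<open>\<open>Load i j\<close>: \<open>X\<^sub>i :=\<close> contents of the register with index \<open>X\<^sub>j\<close>\<close>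
  | Store nat nat      \<comment> \<open>\<open>Store i j\<close>: register with index \<open>X\<^sub>i\<close> \<open>:= X\<^sub>j\<close>\<close>
  | JumpPos nat nat    \<comment> \<open>\<open>JumpPos i m\<close>: continue at instruction \<open>m\<close> if \<open>X\<^sub>i > 0\<close>\<close>
  | Print nat          \<comment> \<open>\<open>Print i\<close>: append \<open>X\<^sub>i\<close> to the output\<close>

record ram_state =
  pc :: nat
  reg :: "nat \<Rightarrow> nat"
  out :: "nat list"

fun exec :: "instr \<Rightarrow> ram_state \<Rightarrow> ram_state" where
  "exec (Const i c) s = s\<lparr>pc := Suc (pc s), reg := (reg s)(i := c)\<rparr>"
| "exec (Add i j l) s = s\<lparr>pc := Suc (pc s), reg := (reg s)(i := reg s j + reg s l)\<rparr>"
| "exec (Sub i j l) s = s\<lparr>pc := Suc (pc s), reg := (reg s)(i := reg s j - reg s l)\<rparr>"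
| "exec (Load i j) s = s\<lparr>pc := Suc (pc s), reg := (reg s)(i := reg s (reg s j))\<rparr>"
| "exec (Store i j) s = s\<lparr>pc := Suc (pc s), reg := (reg s)(reg s i := reg s j)\<rparr>"
| "exec (JumpPos i m) s = s\<lparr>pc := (if reg s i > 0 then m else Suc (pc s))\<rparr>"
| "exec (Print i) s = s\<lparr>pc := Suc (pc s), out := out s @ [reg s i]\<rparr>"

definition halted :: "instr list \<Rightarrow> ram_state \<Rightarrow> bool" where
  "halted P s \<longleftrightarrow> length P \<le> pc s"

definition step :: "instr list \<Rightarrow> ram_state \<Rightarrow> ram_state" where
  "step P s = (if halted P s then s else exec (P ! pc s) s)"

definition initial_state :: "nat \<Rightarrow> ram_state" where
  "initial_state x = \<lparr>pc = 0, reg = (\<lambda>_. 0)(0 := x), out = []\<rparr>"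

text \<open>On input \<open>x\<close>, the program halts after at most \<open>t\<close> steps with output \<open>ys\<close>; halted states
  are fixed points of \<^const>\<open>step\<close>.\<close>

definition outputs_within :: "instr list \<Rightarrow> nat \<Rightarrow> nat list \<Rightarrow> nat \<Rightarrow> bool" where
  "outputs_within P x ys t \<longleftrightarrow>
     (let s = (step P ^^ t) (initial_state x) in halted P s \<and> out s = ys)"

text \<open>The list \<open>[c\<^sub>1, \<dots>, c\<^sub>n]\<close> encodes the coloring \<open>i \<mapsto> c\<^sub>i\<close> of \<open>{1..n}\<close>.\<close>

definition coloring_of_list :: "nat list \<Rightarrow> nat \<Rightarrow> nat" where
  "coloring_of_list ys i = ys ! (i - 1)"

end

theory Submission imports Defs begin

text \<open>
  Color \<open>1, \<dots>, n\<close> one after the other by the method of conditional expectations. Give a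
  progression and a color \<open>c\<close> the weight \<open>2\<^sup>j\<close> if \<open>j\<close> of its elements have color \<open>c\<close> and
  the others are uncolored, and \<open>0\<close> if some element has the other color. The average of the total
  weight over the two colors of the next number is the present total, so the better color does
  not increase it. Initially the total is twice the number of progressions, which is less than
  \<open>2\<^sup>k\<close> since \<open>n\<^sup>2 < k 2\<^bsup>k-1\<^esup>\<close>, while a monochromatic \<open>k\<close>-AP alone would weigh \<open>2\<^sup>k\<close>.

  A total weight costs \<open>O(n\<^sup>2 k)\<close> steps, so the coloring takes \<open>O(n\<^sup>3 k)\<close> steps.
\<close>

section \<open>Structured programs\<close>

text \<open>The machine's only jump is taken on a positive register. So the conditional runs its
  body at 0, the loop tests after its body, and each costs a single jump instruction.\<close>

datatype com =
    Op instr
  | Seq com com (infixr ";;" 60)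
  | Unless nat com
  | DoWhile com nat

primrec code_length :: "com \<Rightarrow> nat" where
  "code_length (Op ins) = 1"
| "code_length (c ;; d) = code_length c + code_length d"
| "code_length (Unless i c) = Suc (code_length c)"
| "code_length (DoWhile c i) = Suc (code_length c)"

text \<open>Jump targets are absolute, hence the start address \<open>p\<close>.\<close>

primrec compile :: "com \<Rightarrow> nat \<Rightarrow> instr list" where
  "compile (Op ins) p = [ins]"
| "compile (c ;; d) p = compile c p @ compile d (p + code_length c)"
| "compile (Unless i c) p = JumpPos i (Suc p + code_length c) # compile c (Suc p)"
| "compile (DoWhile c i) p = compile c p @ [JumpPos i p]"

lemma length_compile [simp]: "length (compile c p) = code_length c"
  by (induction c arbitrary: p) auto

fun is_jump :: "instr \<Rightarrow> bool" where
  "is_jump (JumpPos i m) = True"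
| "is_jump _ = False"

text \<open>The time counts machine steps exactly, jumps included. \<open>Op\<close> excludes jumps,
  whose effect is not invariant under shifting the code.\<close>

inductive big_step ::
  "com \<Rightarrow> (nat \<Rightarrow> nat) \<Rightarrow> nat list \<Rightarrow> nat \<Rightarrow> (nat \<Rightarrow> nat) \<Rightarrow> nat list \<Rightarrow> bool" where
  Op: "\<not> is_jump ins \<Longrightarrow> exec ins \<lparr>pc = 0, reg = r, out = u\<rparr> = \<lparr>pc = 1, reg = r', out = u'\<rparr> \<Longrightarrow>
    big_step (Op ins) r u 1 r' u'"
| Seq: "big_step c r u t r' u' \<Longrightarrow> big_step d r' u' t' r'' u'' \<Longrightarrow>
    big_step (c ;; d) r u (t + t') r'' u''"
| Unless_skip: "r i > 0 \<Longrightarrow> big_step (Unless i c) r u 1 r u"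
| Unless_run: "r i = 0 \<Longrightarrow> big_step c r u t r' u' \<Longrightarrow> big_step (Unless i c) r u (Suc t) r' u'"
| DoWhile_stop: "big_step c r u t r' u' \<Longrightarrow> r' i = 0 \<Longrightarrow>
    big_step (DoWhile c i) r u (Suc t) r' u'"
| DoWhile_loop: "big_step c r u t r' u' \<Longrightarrow> r' i > 0 \<Longrightarrow>
    big_step (DoWhile c i) r' u' t' r'' u'' \<Longrightarrow>
    big_step (DoWhile c i) r u (Suc t + t') r'' u''"

section \<open>Correctness of compilation\<close>

definition code_at :: "instr list \<Rightarrow> nat \<Rightarrow> instr list \<Rightarrow> bool" where
  "code_at P p xs \<longleftrightarrow> (\<exists>as bs. P = as @ xs @ bs \<and> length as = p)"

lemma code_at_append:
  "code_at P p (xs @ ys) \<Longrightarrow> code_at P p xs \<and> code_at P (p + length xs) ys"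
  unfolding code_at_def by (metis append.assoc length_append)

lemma code_at_Cons:
  "code_at P p (x # ys) \<Longrightarrow> p < length P \<and> P ! p = x \<and> code_at P (Suc p) ys"
proof -
  assume a: "code_at P p (x # ys)"
  then have "code_at P p ([x] @ ys)" by simp
  then have "code_at P (Suc p) ys" by (metis code_at_append One_nat_def add.commute length_Cons
     list.size(3) plus_1_eq_Suc)
  then show ?thesis using a by (auto simp: code_at_def)
qed

lemma step_at:
  "p < length P \<Longrightarrow> step P \<lparr>pc = p, reg = r, out = u\<rparr> = exec (P ! p) \<lparr>pc = p, reg = r, out = u\<rparr>"
  by (simp add: step_def halted_def)

lemma exec_pc_shift:
  "\<not> is_jump ins \<Longrightarrow> exec ins \<lparr>pc = 0, reg = r, out = u\<rparr> = \<lparr>pc = 1, reg = r', out = u'\<rparr> \<Longrightarrow>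
   exec ins \<lparr>pc = p, reg = r, out = u\<rparr> = \<lparr>pc = Suc p, reg = r', out = u'\<rparr>"
  by (cases ins) auto

lemma funpow_add_apply: "(f ^^ (m + n)) x = (f ^^ n) ((f ^^ m) x)"
  by (metis add.commute comp_apply funpow_add)

lemma compile_correct:
  "big_step c r u t r' u' \<Longrightarrow> code_at P p (compile c p) \<Longrightarrow>
   (step P ^^ t) \<lparr>pc = p, reg = r, out = u\<rparr> = \<lparr>pc = p + code_length c, reg = r', out = u'\<rparr>"
proof (induction arbitrary: p rule: big_step.induct)
  case (Op ins r u r' u')
  then show ?case
    using code_at_Cons[of P p ins "[]"] exec_pc_shift[OF Op(1,2), of p] by (simp add: step_at)
next
  case (Seq c r u t r' u' d t' r'' u'')
  then show ?case
    using code_at_append[of P p "compile c p" "compile d (p + code_length c)"]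
    by (simp add: funpow_add_apply add.assoc)
next
  case (Unless_skip r i c u)
  then show ?case
    using code_at_Cons[of P p "JumpPos i (Suc p + code_length c)"] by (simp add: step_at)
next
  case (Unless_run r i c u t r' u')
  then show ?case
    using code_at_Cons[of P p "JumpPos i (Suc p + code_length c)"]
    by (simp add: step_at funpow_Suc_right del: funpow.simps)
next
  case (DoWhile_stop c r u t r' u' i)
  then show ?case
    using code_at_append[of P p "compile c p" "[JumpPos i p]"]
      code_at_Cons[of P "p + code_length c" "JumpPos i p" "[]"]
    by (simp add: step_at)
next
  case (DoWhile_loop c r u t r' u' i t' r'' u'')
  \<comment> \<open>One pass and the jump lead back to address \<open>p\<close>, where the induction
    hypothesis covers the remaining passes.\<close>
  then have "(step P ^^ Suc t) \<lparr>pc = p, reg = r, out = u\<rparr> = \<lparr>pc = p, reg = r', out = u'\<rparr>"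
    using code_at_append[of P p "compile c p" "[JumpPos i p]"]
      code_at_Cons[of P "p + code_length c" "JumpPos i p" "[]"]
    by (simp add: step_at)
  with DoWhile_loop show ?case
    by (simp only: funpow_add_apply)
qed

text \<open>The last argument of the postcondition is a clock, so that time bounds are ordinary
  postconditions.\<close>

definition wp :: "com \<Rightarrow> ((nat \<Rightarrow> nat) \<Rightarrow> nat list \<Rightarrow> nat \<Rightarrow> bool) \<Rightarrow>
    (nat \<Rightarrow> nat) \<Rightarrow> nat list \<Rightarrow> nat \<Rightarrow> bool" where
  "wp c Q r u t \<longleftrightarrow> (\<exists>t' r' u'. big_step c r u t' r' u' \<and> Q r' u' (t + t'))"

lemma wp_Op:
  assumes "\<not> is_jump ins" "exec ins \<lparr>pc = 0, reg = r, out = u\<rparr> = \<lparr>pc = 1, reg = r', out = u'\<rparr>"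
    "Q r' u' (Suc t)"
  shows "wp (Op ins) Q r u t"
proof -
  have "Q r' u' (t + 1)" using assms(3) by simp
  with big_step.Op[OF assms(1,2)] show ?thesis unfolding wp_def by blast
qed

lemma wp_Const: "Q (r(i := c)) u (Suc t) \<Longrightarrow> wp (Op (Const i c)) Q r u t"
  and wp_Add: "Q (r(i := r j + r l)) u (Suc t) \<Longrightarrow> wp (Op (Add i j l)) Q r u t"
  and wp_Sub: "Q (r(i := r j - r l)) u (Suc t) \<Longrightarrow> wp (Op (Sub i j l)) Q r u t"
  and wp_Load: "Q (r(i := r (r j))) u (Suc t) \<Longrightarrow> wp (Op (Load i j)) Q r u t"
  and wp_Store: "Q (r(r i := r j)) u (Suc t) \<Longrightarrow> wp (Op (Store i j)) Q r u t"
  and wp_Print: "Q r (u @ [r i]) (Suc t) \<Longrightarrow> wp (Op (Print i)) Q r u t"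
  by (auto intro!: wp_Op)

lemma wp_Seq: "wp c (wp d Q) r u t \<Longrightarrow> wp (c ;; d) Q r u t"
  unfolding wp_def by (metis add.assoc big_step.Seq)

lemma wp_Unless:
  "(r i > 0 \<Longrightarrow> Q r u (Suc t)) \<Longrightarrow> (r i = 0 \<Longrightarrow> wp c Q r u (Suc t)) \<Longrightarrow> wp (Unless i c) Q r u t"
  unfolding wp_def
  by (cases "r i = 0") (fastforce intro: big_step.Unless_skip big_step.Unless_run)+

lemma wp_mono: "wp c Q r u t \<Longrightarrow> (\<And>r u t. Q r u t \<Longrightarrow> Q' r u t) \<Longrightarrow> wp c Q' r u t"
  unfolding wp_def by blast

text \<open>A single unrolling, with the rest of the loop in the postcondition. Termination comes
  from the inductions in the loop lemmas below.\<close>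

lemma wp_DoWhile:
  assumes "wp c (\<lambda>r u t. if r i = 0 then Q r u (Suc t) else wp (DoWhile c i) Q r u (Suc t)) r u t"
  shows "wp (DoWhile c i) Q r u t"
proof -
  obtain t' r' u' where b: "big_step c r u t' r' u'"
    and q: "if r' i = 0 then Q r' u' (Suc (t + t')) else wp (DoWhile c i) Q r' u' (Suc (t + t'))"
    using assms unfolding wp_def[of c] by blast
  show ?thesis
  proof (cases "r' i = 0")
    case True
    then have "Q r' u' (t + Suc t')" using q by simp
    with big_step.DoWhile_stop[of c, OF b True] show ?thesis unfolding wp_def by blast
  next
    case False
    then obtain t'' r'' u'' where
      l: "big_step (DoWhile c i) r' u' t'' r'' u''" "Q r'' u'' (Suc (t + t') + t'')"
      using q unfolding wp_def by auto
    have "big_step (DoWhile c i) r u (Suc t' + t'') r'' u''"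
      using False by (intro big_step.DoWhile_loop[OF b _ l(1)]) simp
    moreover have "Q r'' u'' (t + (Suc t' + t''))" using l(2) by (simp add: add.assoc)
    ultimately show ?thesis unfolding wp_def by blast
  qed
qed

text \<open>Code placed at address 0 with nothing after it ends at its own length, which is a halted
  state.\<close>

lemma wp_outputs_within:
  assumes "wp c (\<lambda>r u t. P u \<and> t \<le> T) ((\<lambda>_. 0)(0 := x)) [] 0"
  shows "\<exists>ys t. P ys \<and> t \<le> T \<and> outputs_within (compile c 0) x ys t"
proof -
  obtain t r' ys where b: "big_step c ((\<lambda>_. 0)(0 := x)) [] t r' ys" and "P ys" "t \<le> T"
    using assms unfolding wp_def by auto
  moreover have "code_at (compile c 0) 0 (compile c 0)" by (simp add: code_at_def)
  from compile_correct[OF b this] have "outputs_within (compile c 0) x ys t"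
    by (simp add: outputs_within_def initial_state_def halted_def)
  ultimately show ?thesis by blast
qed

section \<open>Conditional expectations\<close>

text \<open>The value 0 stands for uncolored, 1 and 2 for the colors. An uncolored element counts 1,
  the mean of the factors 2 and 0 that its two colorings would give.\<close>

definition factor :: "nat \<Rightarrow> nat \<Rightarrow> nat" where
  "factor c v = (if v = 0 then 1 else if v = c then 2 else 0)"

text \<open>For \<open>d > 0\<close> and a color \<open>c\<close>, this is \<open>2 ^ k\<close>
  times the probability that fair coin flips for the uncolored elements make the whole progression
  \<open>c\<close>.\<close>

definition weight :: "nat \<Rightarrow> (nat \<Rightarrow> nat) \<Rightarrow> nat \<Rightarrow> nat \<Rightarrow> nat \<Rightarrow> nat" where
  "weight k f c a d = (\<Prod>i<k. factor c (f (a + i * d)))"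

definition contribution :: "nat \<Rightarrow> nat \<Rightarrow> (nat \<Rightarrow> nat) \<Rightarrow> nat \<Rightarrow> nat \<Rightarrow> nat" where
  "contribution k n f a d =
     (if a + (k - 1) * d \<le> n then weight k f 1 a d + weight k f 2 a d else 0)"

text \<open>The sum runs over a full square, progressions beyond \<open>n\<close> counting 0, to
  match two nested loops with fixed bounds.\<close>

definition potential :: "nat \<Rightarrow> nat \<Rightarrow> (nat \<Rightarrow> nat) \<Rightarrow> nat" where
  "potential k n f = (\<Sum>d\<in>{0<..n}. \<Sum>a\<in>{0<..n}. contribution k n f a d)"

text \<open>Peels off the first element, in the order in which the program walks along a
  progression.\<close>

lemma weight_Suc: "weight (Suc m) f c a d = factor c (f a) * weight m f c (a + d) d"
  unfolding weight_def by (subst prod.lessThan_Suc_shift) (simp add: algebra_simps)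

text \<open>As \<open>d > 0\<close>, at most one index hits \<open>x\<close>. Its factor is 1 before
  and 2 or 0 after; all others are unchanged.\<close>

lemma weight_average:
  assumes "f x = 0" "d > 0" "c \<in> {1, 2}"
  shows "weight k (f(x := 1)) c a d + weight k (f(x := 2)) c a d = 2 * weight k f c a d"
proof (cases "\<exists>i<k. a + i * d = x")
  case True
  then obtain i where i: "i < k" "a + i * d = x" by auto
  have split: "weight k g c a d = factor c (g x) * (\<Prod>j\<in>{..<k} - {i}. factor c (g (a + j * d)))"
    for g unfolding weight_def using i by (subst prod.remove[of _ i]) auto
  have "a + j * d \<noteq> x" if "j \<noteq> i" for j using that i \<open>d > 0\<close> by auto
  then have rest: "(\<Prod>j\<in>{..<k} - {i}. factor c ((f(x := v)) (a + j * d))) =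
      (\<Prod>j\<in>{..<k} - {i}. factor c (f (a + j * d)))" for v
    by (intro prod.cong) auto
  show ?thesis unfolding split rest using assms by (auto simp: factor_def)
next
  case False
  then have "weight k (f(x := v)) c a d = weight k f c a d" for v
    unfolding weight_def by (intro prod.cong) auto
  then show ?thesis by simp
qed

lemma potential_average:
  assumes "f x = 0"
  shows "potential k n (f(x := 1)) + potential k n (f(x := 2)) = 2 * potential k n f"
proof -
  have "weight k (f(x := 1)) 1 a d + weight k (f(x := 1)) 2 a d +
      (weight k (f(x := 2)) 1 a d + weight k (f(x := 2)) 2 a d) =
      2 * (weight k f 1 a d + weight k f 2 a d)" if "d > 0" for a d
    using weight_average[of f x d 1 k a] weight_average[of f x d 2 k a] assms that by simp
  then show ?thesis
    unfolding potential_def contribution_def sum.distrib[symmetric] sum_distrib_left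
    by (intro sum.cong refl) auto
qed

text \<open>Compares the sum with a triangle of area \<open>n^2 / (2 * m)\<close>. The squared
  remainder is carried for the induction: \<open>(v + m)^2\<close> exceeds \<open>v^2\<close> by at
  least \<open>2 * m * v\<close>.\<close>

lemma sum_diff_mult_le: "2 * m * (\<Sum>d\<in>{0<..D}. n - m * d) + (n - m * D)\<^sup>2 \<le> (n::nat)\<^sup>2"
proof (induction D)
  case (Suc D)
  define v where "v = n - m * Suc D"
  have "2 * m * v + v\<^sup>2 \<le> (n - m * D)\<^sup>2"
  \<comment> \<open>With truncated subtraction, \<open>v > 0\<close> guarantees that the remainder
    dropped by exactly \<open>m\<close>; for \<open>v = 0\<close> the left side vanishes.\<close>
  proof (cases "v = 0")
    case False
    then have "n - m * D = v + m" unfolding v_def by simp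
    then show ?thesis by (simp add: power2_eq_square algebra_simps)
  qed simp
  moreover have "{0<..Suc D} = insert (Suc D) {0<..D}" by auto
  ultimately show ?case using Suc v_def by (simp add: algebra_simps)
qed simp

text \<open>With \<open>m = k - 1\<close>, the difference \<open>d\<close> admits
  \<open>n - m * d\<close> first terms, so the potential is \<open>2 * N\<close>. Then
  \<open>2 * m * N <= n^2 < (m + 1) * 2^m <= 2 * m * 2^m\<close> gives
  \<open>N < 2^m\<close>.\<close>

lemma potential_zero_less:
  assumes "2 * n\<^sup>2 < k * 2 ^ k" "k > 0"
  shows "potential k n (\<lambda>_. 0) < 2 ^ k"
\<comment> \<open>For \<open>k = 1\<close> the factor \<open>m\<close> would be 0 and could not be
  cancelled, but the hypothesis leaves only \<open>n = 0\<close>.\<close>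
proof (cases "k = 1")
  case True
  then have "n = 0" using assms by (cases n) auto
  then show ?thesis by (simp add: potential_def)
next
  case False
  then obtain m where m: "k = Suc m" "m > 0" using assms(2) by (cases k) auto
  define N where "N = (\<Sum>d\<in>{0<..n}. n - m * d)"
  have "(\<Sum>a\<in>{0<..n}. if a + m * d \<le> n then 2 else 0) = 2 * (n - m * d)" for d :: nat
  proof -
    have "{0<..n} \<inter> {a. a + m * d \<le> n} = {0<..n - m * d}" if "m * d \<le> n" using that by auto
    moreover have "{0<..n} \<inter> {a. a + m * d \<le> n} = {}" if "\<not> m * d \<le> n" using that by auto
    ultimately show ?thesis by (cases "m * d \<le> n") (simp_all flip: sum.inter_restrict
      add: sum.If_cases Collect_conj_eq)
  qed
  moreover have "weight k (\<lambda>_. 0) 1 a d + weight k (\<lambda>_. 0) 2 a d = 2" for a d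
    unfolding weight_def factor_def by simp
  ultimately have pot: "potential k n (\<lambda>_. 0) = 2 * N"
    unfolding potential_def contribution_def N_def using m by (simp add: sum_distrib_left cong: if_cong del: One_nat_def)
  have "2 * m * N \<le> n\<^sup>2" using sum_diff_mult_le[of m n n] unfolding N_def by simp
  also have "n\<^sup>2 < Suc m * 2 ^ m" using assms m by simp
  also have "\<dots> \<le> 2 * m * 2 ^ m" using m by (intro mult_right_mono) auto
  finally have "N < 2 ^ m" using m by simp
  then show ?thesis using pot m by simp
qed

text \<open>A monochromatic progression would alone contribute \<open>2 ^ k\<close>. The map
  \<open>f\<close> uses the machine's colors 1 and 2, \<open>g\<close> the colors 0 and 1 of the
  definition.\<close>

lemma proper_coloring_of_potential:
  assumes pot: "potential k n f < 2 ^ k"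
    and col: "\<And>y. 0 < y \<Longrightarrow> y \<le> n \<Longrightarrow> f y \<in> {1, 2}"
    and g: "\<And>y. 0 < y \<Longrightarrow> y \<le> n \<Longrightarrow> g y = f y - 1"
    and k: "k > 0" and n: "k = 1 \<Longrightarrow> n = 0"
  shows "proper_coloring k n g"
  unfolding proper_coloring_def
proof (intro conjI notI)
  have "g y \<in> {0, 1}" if "y \<in> {1..n}" for y
    using that col[of y] g[of y] by auto
  then show "g \<in> two_colorings n"
    unfolding two_colorings_def by blast
  assume "\<exists>A. is_AP k A \<and> A \<subseteq> {1..n} \<and> monochromatic g A"
  then obtain A where A: "is_AP k A" "A \<subseteq> {1..n}" "monochromatic g A" by blast
  obtain a d where ad: "a > 0" "d > 0" "A = {a + i * d | i. i < k}"
    using A(1) unfolding is_AP_def by blast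
  obtain c where c: "\<forall>x\<in>A. g x = c"
    using A(3) unfolding monochromatic_def by blast
  have sub: "a + i * d \<in> {1..n}" and mono: "g (a + i * d) = c" if "i < k" for i
    using A(2) ad(3) c that by auto
  have last: "a + (k - 1) * d \<le> n" using sub[of "k - 1"] k by simp
  have "n > 0" using last ad by simp
  \<comment> \<open>Since \<open>n > 0\<close> rules out \<open>k = 1\<close>, the last term bounds
    the difference, and \<open>d\<close> lies in the summation range.\<close>
  with n k have "1 \<le> k - 1" by (cases "k = 1") auto
  then have "1 * d \<le> (k - 1) * d" by (rule mult_right_mono) simp
  then have "d \<le> (k - 1) * d" by simp
  with last have "d \<le> n" by linarith
  have col_c: "f (a + i * d) = Suc c" if "i < k" for i
  proof -
    have "0 < a + i * d" "a + i * d \<le> n" using sub[OF that] by auto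
    from col[OF this] g[OF this] mono[OF that] show ?thesis by auto
  qed
  have "c = 0 \<or> c = 1"
    using col_c[of 0] col[of a] sub[of 0] k by auto
  moreover have "weight k f (Suc c) a d = 2 ^ k"
    unfolding weight_def using col_c by (simp add: factor_def)
  ultimately have "2 ^ k \<le> weight k f 1 a d + weight k f 2 a d"
    by (auto simp: numeral_2_eq_2)
  also have "\<dots> = contribution k n f a d"
    using last by (simp add: contribution_def)
  also have "\<dots> \<le> (\<Sum>a\<in>{0<..n}. contribution k n f a d)"
    using ad last by (intro member_le_sum) auto
  also have "\<dots> \<le> potential k n f"
    unfolding potential_def using ad \<open>d \<le> n\<close>
    by (intro member_le_sum[of d _ "\<lambda>d. \<Sum>a\<in>{0<..n}. contribution k n f a d"]) auto
  finally show False using pot by simp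
qed

section \<open>The length of the coloring\<close>

lemma vdW_bound_square: "2 * (vdW_bound k)\<^sup>2 = real (k * 2 ^ k)"
proof -
  have "(2 powr ((real k - 1) / 2))\<^sup>2 = 2 powr (real k - 1)"
    by (simp add: powr_power diff_divide_distrib)
  also have "\<dots> = 2 ^ k / 2" by (simp add: powr_diff powr_realpow)
  finally show ?thesis by (simp add: vdW_bound_def power_mult_distrib)
qed

lemma vdW_bound_nonneg: "0 \<le> vdW_bound k"
  by (simp add: vdW_bound_def)

text \<open>Squaring and doubling leave an integer test that a machine without roots or division can
  evaluate.\<close>

lemma less_vdW_bound_iff: "real n < vdW_bound k \<longleftrightarrow> 2 * n\<^sup>2 < k * 2 ^ k"
proof -
  have "real n < vdW_bound k \<longleftrightarrow> (real n)\<^sup>2 < (vdW_bound k)\<^sup>2"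
    using vdW_bound_nonneg[of k]
    by (metis of_nat_0_le_iff power2_less_imp_less power_strict_mono pos2)
  also have "\<dots> \<longleftrightarrow> 2 * (real n)\<^sup>2 < 2 * (vdW_bound k)\<^sup>2" by simp
  also have "\<dots> \<longleftrightarrow> real (2 * n\<^sup>2) < real (k * 2 ^ k)" unfolding vdW_bound_square by simp
  finally show ?thesis unfolding of_nat_less_iff .
qed

text \<open>\<open>GREATEST\<close> is meaningful because 0 qualifies and the ceiling bounds all
  candidates. The equivalence uses that the condition is downward closed.\<close>

lemma le_coloring_length_iff:
  assumes "k > 0"
  shows "n \<le> coloring_length k \<longleftrightarrow> real n < vdW_bound k"
proof -
  have bdd: "m \<le> nat \<lceil>vdW_bound k\<rceil>" if "real m < vdW_bound k" for m
    using that by linarith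
  have "real 0 < vdW_bound k" using assms by (simp add: vdW_bound_def)
  then have "real (coloring_length k) < vdW_bound k"
    unfolding coloring_length_def using bdd by (rule GreatestI_nat)
  moreover have "n \<le> coloring_length k" if "real n < vdW_bound k"
    unfolding coloring_length_def using that bdd by (rule Greatest_le_nat)
  ultimately show ?thesis by (meson le_less_trans of_nat_mono)
qed

section \<open>The program\<close>

text \<open>
  Registers: \<open>0\<close> holds \<open>k\<close>, \<open>1, 20, 19, 21\<close> the constants \<open>1, 2, 32, 0\<close>, \<open>3\<close> holds \<open>n\<close>, \<open>6\<close>
  holds \<open>n + 32\<close>; \<open>7\<close> counts the numbers still to be colored and \<open>8\<close> is the address of the
  current one. Register \<open>10\<close> accumulates the potential over differences \<open>11\<close> and first terms \<open>12\<close>;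
  \<open>13\<close> is the address of the current element, \<open>14, 15\<close> are the two weights, \<open>16\<close> counts
  elements. Register \<open>32 + y\<close> is \<open>0\<close> if \<open>y\<close> is uncolored and otherwise its color plus \<open>1\<close>, so
  that the registers need no initialization.
\<close>

definition element_code :: com where
  "element_code =
     Op (Load 17 13) ;; Op (Sub 18 1 17) ;;
     Unless 18
      (Op (Sub 18 17 1) ;; Unless 18 (Op (Add 14 14 14) ;; Op (Const 15 0)) ;;
       Op (Sub 18 20 17) ;; Unless 18 (Op (Add 15 15 15) ;; Op (Const 14 0))) ;;
     Op (Add 13 13 11) ;; Op (Sub 16 16 1)"

text \<open>After its loop, register \<open>13\<close> is one difference beyond the last element, hence the
  subtraction before the comparison with \<open>n + 32\<close>.\<close>

definition progression_code :: com where
  "progression_code =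
     Op (Add 13 12 19) ;; Op (Const 14 1) ;; Op (Const 15 1) ;; Op (Add 16 0 21) ;;
     DoWhile element_code 16 ;;
     Op (Sub 5 13 11) ;; Op (Sub 5 5 6) ;;
     Unless 5 (Op (Add 10 10 14) ;; Op (Add 10 10 15)) ;;
     Op (Sub 12 12 1)"

text \<open>The counters themselves serve as difference and first term, running from
  \<open>n\<close> down to 1, so that reaching 0 ends a loop.\<close>

definition potential_code :: com where
  "potential_code =
     Op (Const 10 0) ;; Op (Add 11 3 21) ;;
     DoWhile (Op (Add 12 3 21) ;; DoWhile progression_code 12 ;; Op (Sub 11 11 1)) 11"

definition emit_code :: com where
  "emit_code = Op (Load 5 8) ;; Op (Sub 5 5 1) ;; Op (Print 5) ;; Op (Sub 7 7 1)"

text \<open>Register 9 keeps the potential for stored value 1 while value 2 is tried. The truncated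
  difference is 0 if value 1 is no worse, and then value 1 is restored.\<close>

definition choice_code :: com where
  "choice_code =
     Op (Add 8 8 1) ;; Op (Store 8 1) ;; potential_code ;; Op (Add 9 10 21) ;;
     Op (Store 8 20) ;; potential_code ;; Op (Sub 5 9 10) ;;
     Unless 5 (Op (Store 8 1)) ;;
     emit_code"

text \<open>Register 3 arrives as \<open>n + 1\<close>. The guard \<open>1 - n\<close> skips the
  loop at \<open>n = 0\<close>, since a \<open>DoWhile\<close> body always runs once.\<close>

definition greedy_code :: com where
  "greedy_code =
     Op (Sub 3 3 1) ;; Op (Add 6 3 19) ;; Op (Add 7 3 21) ;; Op (Add 8 19 21) ;;
     Op (Sub 5 1 3) ;; Unless 5 (DoWhile choice_code 7)"

text \<open>Increments register \<open>3\<close> and keeps its square in register \<open>4\<close>; the loop below leaves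
  \<open>n + 1\<close>, the least number whose doubled square is at least \<open>k 2\<^sup>k\<close>.\<close>

definition square_code :: com where
  "square_code =
     Op (Add 4 4 3) ;; Op (Add 3 3 1) ;; Op (Add 4 4 3) ;; Op (Sub 5 2 4) ;; Op (Sub 5 5 4)"

text \<open>Repeated doubling replaces the multiplication \<open>k * 2 ^ k\<close>. Register 21
  stays 0, so adding it copies a register.\<close>

definition coloring_code :: com where
  "coloring_code =
     Op (Const 1 1) ;; Op (Const 20 2) ;; Op (Const 19 32) ;;
     Op (Add 2 0 21) ;; Op (Add 16 0 21) ;;
     DoWhile (Op (Add 2 2 2) ;; Op (Sub 16 16 1)) 16 ;;
     DoWhile square_code 5 ;; greedy_code"

section \<open>Verification of the program\<close>

text \<open>Truncated differences test the cell value \<open>v\<close>: \<open>1 - v\<close> is 0 if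
  the cell is colored, and then \<open>v - 1\<close> is 0 for value 1, \<open>2 - v\<close> for
  value 2.\<close>

lemma wp_element:
  assumes "r 1 = 1" "r 20 = 2" "32 \<le> r 13" "r (r 13) \<le> 2"
    and post: "\<And>r' t'. (\<And>i. i \<notin> {13..18} \<Longrightarrow> r' i = r i) \<Longrightarrow> r' 13 = r 13 + r 11 \<Longrightarrow>
      r' 14 = r 14 * factor 1 (r (r 13)) \<Longrightarrow> r' 15 = r 15 * factor 2 (r (r 13)) \<Longrightarrow>
      r' 16 = r 16 - 1 \<Longrightarrow> t' \<le> t + 12 \<Longrightarrow> Q r' u t'"
  shows "wp element_code Q r u t"
  unfolding element_code_def
  apply (intro wp_Seq wp_Load wp_Sub wp_Unless wp_Add wp_Const)
  using assms(1-4) by (auto intro!: post simp: factor_def)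

text \<open>Induction on the remaining elements: by \<open>weight_Suc\<close> the later passes
  handle the progression that starts at the second element. A pass costs 12 plus the jump.\<close>

lemma wp_elements:
  assumes "r 1 = 1" "r 20 = 2" "r 16 = m" "m > 0" "32 \<le> r 13" "\<And>y. r (32 + y) \<le> 2"
    and "\<And>r' t'. (\<And>i. i \<notin> {13..18} \<Longrightarrow> r' i = r i) \<Longrightarrow> r' 13 = r 13 + m * r 11 \<Longrightarrow>
      r' 14 = r 14 * weight m (\<lambda>y. r (32 + y)) 1 (r 13 - 32) (r 11) \<Longrightarrow>
      r' 15 = r 15 * weight m (\<lambda>y. r (32 + y)) 2 (r 13 - 32) (r 11) \<Longrightarrow>
      t' \<le> t + 13 * m \<Longrightarrow> Q r' u t'"
  shows "wp (DoWhile element_code 16) Q r u t"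
  using assms
proof (induction m arbitrary: r t)
  case (Suc m)
  note post = Suc.prems(7)
  have at: "r (r 13) = r (32 + (r 13 - 32))" using Suc.prems(5) by simp
  show ?case
  proof (rule wp_DoWhile, rule wp_element)
    show "r (r 13) \<le> 2" using Suc.prems(6) at by metis
    fix r' t'
    assume frame: "\<And>i. i \<notin> {13..18} \<Longrightarrow> r' i = r i" and r': "r' 13 = r 13 + r 11"
      "r' 14 = r 14 * factor 1 (r (r 13))" "r' 15 = r 15 * factor 2 (r (r 13))" "r' 16 = r 16 - 1"
      and t': "t' \<le> t + 12"
    have eqs: "r' 1 = r 1" "r' 20 = r 20" "r' 11 = r 11" "\<And>y. r' (32 + y) = r (32 + y)"
      by (simp_all add: frame)
    show "if r' 16 = 0 then Q r' u (Suc t') else wp (DoWhile element_code 16) Q r' u (Suc t')"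
    proof (cases "m = 0")
      case True
      with r' Suc.prems(3) t' show ?thesis
        by (auto intro!: post frame simp: weight_def at)
    next
      case False
      have "wp (DoWhile element_code 16) Q r' u (Suc t')"
      proof (rule Suc.IH)
        fix r'' t''
        assume frame': "\<And>i. i \<notin> {13..18} \<Longrightarrow> r'' i = r' i"
          and r'': "r'' 13 = r' 13 + m * r' 11"
          "r'' 14 = r' 14 * weight m (\<lambda>y. r' (32 + y)) 1 (r' 13 - 32) (r' 11)"
          "r'' 15 = r' 15 * weight m (\<lambda>y. r' (32 + y)) 2 (r' 13 - 32) (r' 11)"
          and t'': "t'' \<le> Suc t' + 13 * m"
        have "r' 13 - 32 = r 13 - 32 + r 11" using r'(1) Suc.prems(5) by simp
        with r'' show "Q r'' u t''"
          using t' t'' by (intro post) (simp_all add: frame frame' eqs r' weight_Suc at)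
      qed (use Suc.prems r' False eqs in simp_all)
      with False r'(4) Suc.prems(3) show ?thesis by simp
    qed
  qed (use Suc.prems in auto)
qed simp

text \<open>The invariant shared by the loops. \<open>k\<close> and \<open>n\<close> must be
  positive because they initialize loops that run at least once.\<close>

definition env :: "nat \<Rightarrow> nat \<Rightarrow> (nat \<Rightarrow> nat) \<Rightarrow> bool" where
  "env k n r \<longleftrightarrow> k > 0 \<and> n > 0 \<and> r 0 = k \<and> r 1 = 1 \<and> r 3 = n \<and> r 6 = n + 32 \<and> r 19 = 32 \<and>
     r 20 = 2 \<and> r 21 = 0 \<and> (\<forall>y. r (32 + y) \<le> 2)"

lemma wp_progression:
  assumes env: "env k n r"
    and post: "\<And>r' t'. (\<And>i. i \<notin> {5, 10} \<union> {12..18} \<Longrightarrow> r' i = r i) \<Longrightarrow> r' 12 = r 12 - 1 \<Longrightarrow>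
      r' 10 = r 10 + contribution k n (\<lambda>y. r (32 + y)) (r 12) (r 11) \<Longrightarrow>
      t' \<le> t + (13 * k + 10) \<Longrightarrow> Q r' u t'"
  shows "wp progression_code Q r u t"
  unfolding progression_code_def
  apply (rule wp_Seq wp_Add wp_Const)+
  apply (rule wp_elements[where m = k])
        apply (use env in \<open>simp_all add: env_def\<close>)[6]
  subgoal premises prems for r' t'
  proof -
    note frame = prems(1)
    obtain j where j: "k = Suc j" using env by (cases k) (auto simp: env_def)
    have r': "r' 11 = r 11" "r' 12 = r 12" "r' 10 = r 10" "r' 6 = n + 32" "r' 1 = 1" "r' 19 = 32"
      using env by (simp_all add: frame env_def)
    have mem: "(\<lambda>y. r' (32 + y)) = (\<lambda>y. r (32 + y))" by (simp add: frame)
    have w: "r' 13 = r 12 + 32 + k * r 11"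
      "r' 14 = weight k (\<lambda>y. r (32 + y)) 1 (r 12) (r 11)"
      "r' 15 = weight k (\<lambda>y. r (32 + y)) 2 (r 12) (r 11)"
      using prems(2-4) env by (simp_all add: env_def)
    \<comment> \<open>The truncated difference is 0 exactly if the last element is at most
      \<open>n\<close>, the test in \<open>contribution\<close>.\<close>
    have sub: "r' 13 - r' 11 - r' 6 = r 12 + (k - 1) * r 11 - n"
      unfolding r' w j by simp
    show ?thesis
      apply (rule wp_Seq wp_Sub)+
      apply (rule wp_Unless)
       apply (rule wp_Sub)
       apply (rule post)
      using env sub prems(5) r' w apply (auto simp: frame env_def contribution_def)[4]
      apply (rule wp_Seq wp_Sub wp_Add)+
      apply (rule post)
      using env sub prems(5) r' w apply (auto simp: frame env_def contribution_def)
      done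
  qed
  done

text \<open>The counter is the current first term, so the first pass supplies the top summand and
  the induction the rest.\<close>

lemma wp_progressions:
  assumes "env k n r" "r 12 = m" "m > 0"
    and "\<And>r' t'. (\<And>i. i \<notin> {5, 10} \<union> {12..18} \<Longrightarrow> r' i = r i) \<Longrightarrow>
      r' 10 = r 10 + (\<Sum>a\<in>{0<..m}. contribution k n (\<lambda>y. r (32 + y)) a (r 11)) \<Longrightarrow>
      t' \<le> t + m * (13 * k + 11) \<Longrightarrow> Q r' u t'"
  shows "wp (DoWhile progression_code 12) Q r u t"
  using assms
proof (induction m arbitrary: r t)
  case (Suc m)
  note post = Suc.prems(4)
  have ins: "{0<..Suc m} = insert (Suc m) {0<..m}" by auto
  show ?case
  proof (rule wp_DoWhile, rule wp_progression)
    show "env k n r" by fact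
    fix r' t'
    assume frame: "\<And>i. i \<notin> {5, 10} \<union> {12..18} \<Longrightarrow> r' i = r i" and r': "r' 12 = r 12 - 1"
      "r' 10 = r 10 + contribution k n (\<lambda>y. r (32 + y)) (r 12) (r 11)"
      and t': "t' \<le> t + (13 * k + 10)"
    have eqs: "r' 11 = r 11" "\<And>y. r' (32 + y) = r (32 + y)"
      by (simp_all add: frame)
    have env': "env k n r'" using Suc.prems(1) by (simp add: env_def frame)
    show "if r' 12 = 0 then Q r' u (Suc t') else wp (DoWhile progression_code 12) Q r' u (Suc t')"
    proof (cases "m = 0")
      case True
      with r' Suc.prems(2) t' show ?thesis
        by (auto intro!: post frame simp: ins[unfolded True])
    next
      case False
      have "wp (DoWhile progression_code 12) Q r' u (Suc t')"
      proof (rule Suc.IH)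
        fix r'' t''
        assume frame': "\<And>i. i \<notin> {5, 10} \<union> {12..18} \<Longrightarrow> r'' i = r' i"
          and r'': "r'' 10 = r' 10 + (\<Sum>a\<in>{0<..m}. contribution k n (\<lambda>y. r' (32 + y)) a (r' 11))"
          and t'': "t'' \<le> Suc t' + m * (13 * k + 11)"
        show "Q r'' u t''"
        proof (rule post)
          show "r'' i = r i" if "i \<notin> {5, 10} \<union> {12..18}" for i
            using frame[OF that] frame'[OF that] by simp
          show "t'' \<le> t + Suc m * (13 * k + 11)" using t' t'' by simp
        qed (use r'' r'(2) Suc.prems(2) in \<open>simp add: ins eqs\<close>)
      qed (use Suc.prems r' False env' in simp_all)
      with False r'(1) Suc.prems(2) show ?thesis by simp
    qed
  qed
qed simp

text \<open>The 3 accounts for setting register 12, decrementing register 11 and the outer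
  jump.\<close>

abbreviation potential_time :: "nat \<Rightarrow> nat \<Rightarrow> nat" where
  "potential_time k n \<equiv> n * (n * (13 * k + 11) + 3)"

lemma wp_differences:
  assumes "env k n r" "r 11 = m" "m > 0"
    and "\<And>r' t'. (\<And>i. i \<notin> {5} \<union> {10..18} \<Longrightarrow> r' i = r i) \<Longrightarrow>
      r' 10 = r 10 + (\<Sum>d\<in>{0<..m}. \<Sum>a\<in>{0<..n}. contribution k n (\<lambda>y. r (32 + y)) a d) \<Longrightarrow>
      t' \<le> t + m * (n * (13 * k + 11) + 3) \<Longrightarrow> Q r' u t'"
  shows "wp (DoWhile (Op (Add 12 3 21) ;; DoWhile progression_code 12 ;; Op (Sub 11 11 1)) 11) Q r u t"
    (is "wp ?loop Q r u t")
  using assms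
proof (induction m arbitrary: r t)
  case (Suc m)
  note post = Suc.prems(4)
  have ins: "{0<..Suc m} = insert (Suc m) {0<..m}" by auto
  show ?case
  proof (rule wp_DoWhile, rule wp_Seq, rule wp_Add, rule wp_Seq, rule wp_progressions)
    show "env k n (r(12 := r 3 + r 21))" "(r(12 := r 3 + r 21)) 12 = n" "n > 0"
      using Suc.prems(1) by (simp_all add: env_def)
    fix r' t'
    assume frame: "\<And>i. i \<notin> {5, 10} \<union> {12..18} \<Longrightarrow> r' i = (r(12 := r 3 + r 21)) i"
      and r': "r' 10 = (r(12 := r 3 + r 21)) 10 +
        (\<Sum>a\<in>{0<..n}. contribution k n (\<lambda>y. (r(12 := r 3 + r 21)) (32 + y)) a ((r(12 := r 3 + r 21)) 11))"
      and t': "t' \<le> Suc t + n * (13 * k + 11)"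
    \<comment> \<open>The state at the end of the pass, after the decrement.\<close>
    define r1 where "r1 = r'(11 := r' 11 - r' 1)"
    have frame1: "r1 i = r i" if "i \<notin> {5} \<union> {10..18}" for i
      using that frame[of i] by (auto simp: r1_def)
    have env1: "env k n r1" using Suc.prems(1) by (simp add: env_def frame1)
    have r1: "r1 11 = m" "r1 10 = r 10 + (\<Sum>a\<in>{0<..n}. contribution k n (\<lambda>y. r (32 + y)) a (Suc m))"
      using r' Suc.prems(1,2) by (simp_all add: r1_def frame env_def)
    have "if r1 11 = 0 then Q r1 u (Suc (Suc t')) else wp ?loop Q r1 u (Suc (Suc t'))"
    proof (cases "m = 0")
      case True
      with r1 t' show ?thesis
        by (auto intro!: post frame1 simp: ins[unfolded True])
    next
      case False
      have "wp ?loop Q r1 u (Suc (Suc t'))"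
      proof (rule Suc.IH)
        fix r'' t''
        assume frame': "\<And>i. i \<notin> {5} \<union> {10..18} \<Longrightarrow> r'' i = r1 i"
          and r'': "r'' 10 = r1 10 + (\<Sum>d\<in>{0<..m}. \<Sum>a\<in>{0<..n}. contribution k n (\<lambda>y. r1 (32 + y)) a d)"
          and t'': "t'' \<le> Suc (Suc t') + m * (n * (13 * k + 11) + 3)"
        have mem: "(\<lambda>y. r1 (32 + y)) = (\<lambda>y. r (32 + y))" by (simp add: frame1)
        show "Q r'' u t''"
        proof (rule post)
          show "r'' i = r i" if "i \<notin> {5} \<union> {10..18}" for i
            using frame1[OF that] frame'[OF that] by simp
          show "t'' \<le> t + Suc m * (n * (13 * k + 11) + 3)" using t' t'' by simp
        qed (simp only: r'' r1 mem ins, simp)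
      qed (use r1 False env1 in simp_all)
      with False r1(1) show ?thesis by simp
    qed
    then show "wp (Op (Sub 11 11 1))
      (\<lambda>r u t. if r 11 = 0 then Q r u (Suc t) else wp ?loop Q r u (Suc t)) r' u t'"
      unfolding r1_def by (rule wp_Sub)
  qed
qed simp

lemma wp_potential:
  assumes env: "env k n r"
    and post: "\<And>r' t'. (\<And>i. i \<notin> {5} \<union> {10..18} \<Longrightarrow> r' i = r i) \<Longrightarrow>
      r' 10 = potential k n (\<lambda>y. r (32 + y)) \<Longrightarrow> t' \<le> t + (potential_time k n + 2) \<Longrightarrow> Q r' u t'"
  shows "wp potential_code Q r u t"
  unfolding potential_code_def
  apply (rule wp_Seq wp_Add wp_Const)+
  apply (rule wp_differences[where n = n and k = k and m = n])
     apply (use env in \<open>simp_all add: env_def\<close>)[3]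
  subgoal premises prems for r' t'
  proof (rule post)
    show "r' i = r i" if "i \<notin> {5} \<union> {10..18}" for i
      using that prems(1)[of i] by auto
    show "r' 10 = potential k n (\<lambda>y. r (32 + y))"
      unfolding prems(2) potential_def by simp
  qed (use prems(3) in simp)
  done

text \<open>By \<open>potential_average\<close> the smaller of the two tried potentials is at most
  the present one. Here \<open>x\<close> numbers are already colored, and the next one has register
  \<open>33 + x\<close>.\<close>

lemma wp_choice:
  assumes env: "env k n r" and x: "r 8 = 32 + x" and free: "r (33 + x) = 0"
    and post: "\<And>r' w t'. w \<in> {0, 1} \<Longrightarrow> (\<And>i. i \<notin> {5, 33 + x} \<union> {7..18} \<Longrightarrow> r' i = r i) \<Longrightarrow>
      r' (33 + x) = Suc w \<Longrightarrow> r' 8 = 33 + x \<Longrightarrow> r' 7 = r 7 - 1 \<Longrightarrow>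
      potential k n (\<lambda>y. r' (32 + y)) \<le> potential k n (\<lambda>y. r (32 + y)) \<Longrightarrow>
      t' \<le> t + (2 * potential_time k n + 15) \<Longrightarrow> Q r' (u @ [w]) t'"
  shows "wp choice_code Q r u t"
proof -
  define f where "f = (\<lambda>y. r (32 + y))"
  have f0: "f (Suc x) = 0" using free by (simp add: f_def)
  define r1 where "r1 = r(8 := 33 + x, 33 + x := 1)"
  have r1: "(r(8 := r 8 + r 1))((r(8 := r 8 + r 1)) 8 := (r(8 := r 8 + r 1)) 1) = r1"
    using env x by (simp add: r1_def env_def)
  have env1: "env k n r1" using env by (auto simp: r1_def env_def)
  have mem1: "(\<lambda>y. r1 (32 + y)) = f(Suc x := 1)" by (auto simp: r1_def f_def)
  \<comment> \<open>Common end of both branches, with \<open>v\<close> the stored value and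
    \<open>w\<close> the printed color.\<close>
  have fin: "wp emit_code Q r4 u t4"
    if "w \<in> {0, 1}" and frame4: "\<And>i. i \<notin> {5, 33 + x} \<union> {7..18} \<Longrightarrow> r4 i = r i"
      and "v = Suc w" "r4 (33 + x) = v" "r4 8 = 33 + x" "r4 7 = r 7"
      "(\<lambda>y. r4 (32 + y)) = f(Suc x := v)" "potential k n (f(Suc x := v)) \<le> potential k n f"
      "t4 + 4 \<le> t + (2 * potential_time k n + 15)" for r4 v w t4
  proof -
    have "r4 1 = 1" using env by (simp add: frame4 env_def)
    then show ?thesis
      unfolding emit_code_def
      apply (intro wp_Seq wp_Load wp_Sub wp_Print)
      apply (rule post)
      using that by (auto simp: f_def)
  qed
  show ?thesis
    unfolding choice_code_def
  proof (rule wp_Seq, rule wp_Add, rule wp_Seq, rule wp_Store, unfold r1, rule wp_Seq,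
      rule wp_potential[OF env1], rule wp_Seq, rule wp_Add, rule wp_Seq, rule wp_Store, rule wp_Seq)
    fix r' t'
    assume frame: "\<And>i. i \<notin> {5} \<union> {10..18} \<Longrightarrow> r' i = r1 i"
      and r': "r' 10 = potential k n (\<lambda>y. r1 (32 + y))"
      and t': "t' \<le> Suc (Suc t) + (potential_time k n + 2)"
    define r2 where "r2 = r'(9 := r' 10, 33 + x := 2)"
    have r2: "(r'(9 := r' 10 + r' 21))((r'(9 := r' 10 + r' 21)) 8 := (r'(9 := r' 10 + r' 21)) 20) = r2"
      using env1 by (simp add: r2_def env_def frame) (simp add: r1_def)
    have frame2: "r2 i = r i" if "i \<notin> {5, 33 + x} \<union> {7..18}" for i
      using that frame[of i] by (auto simp: r2_def r1_def)
    have r2': "r2 9 = potential k n (f(Suc x := 1))" "r2 8 = 33 + x" "r2 7 = r 7" "r2 (33 + x) = 2"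
      using r' by (simp_all add: r2_def mem1 frame) (simp_all add: r1_def)
    have mem2: "(\<lambda>y. r2 (32 + y)) = f(Suc x := 2)"
      by (rule ext) (auto simp: r2_def r1_def frame f_def)
    have env2: "env k n r2" using env unfolding env_def
      using fun_cong[OF mem2] by (auto simp: frame2 f_def)
    show "wp potential_code (wp (Op (Sub 5 9 10) ;; Unless 5 (Op (Store 8 1)) ;;
      emit_code) Q)
      ((r'(9 := r' 10 + r' 21))((r'(9 := r' 10 + r' 21)) 8 := (r'(9 := r' 10 + r' 21)) 20))
      u (Suc (Suc t'))"
      unfolding r2
    proof (rule wp_potential[OF env2])
      fix r'' t''
      assume frame'': "\<And>i. i \<notin> {5} \<union> {10..18} \<Longrightarrow> r'' i = r2 i"
        and r'': "r'' 10 = potential k n (\<lambda>y. r2 (32 + y))"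
        and t'': "t'' \<le> Suc (Suc t') + (potential_time k n + 2)"
      have r3: "r'' 9 = potential k n (f(Suc x := 1))" "r'' 10 = potential k n (f(Suc x := 2))"
        "r'' 8 = 33 + x" "r'' 7 = r 7" "r'' (33 + x) = 2" "r'' 1 = 1"
        using r'' env2 by (simp_all add: frame'' r2' mem2 env_def)
      have frame3: "r'' i = r i" if "i \<notin> {5, 33 + x} \<union> {7..18}" for i
        using that frame''[of i] frame2[of i] by auto
      have mem3: "(\<lambda>y. r'' (32 + y)) = f(Suc x := 2)"
        using mem2 by (simp add: frame'')
      note avg = potential_average[of f "Suc x" k n, OF f0]
      show "wp (Op (Sub 5 9 10) ;; Unless 5 (Op (Store 8 1)) ;;
        emit_code) Q r'' u t''"
      proof (rule wp_Seq, rule wp_Sub, rule wp_Seq, rule wp_Unless)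
        let ?r = "r''(5 := r'' 9 - r'' 10)"
        assume "?r 5 > 0"
        \<comment> \<open>A positive difference means that value 2 gives the smaller
          potential.\<close>
        then have "potential k n (f(Suc x := 2)) \<le> potential k n f"
          using avg r3 by simp
        moreover have "(\<lambda>y. ?r (32 + y)) = f(Suc x := 2)" using mem3 by simp
        ultimately show "wp emit_code Q
            ?r u (Suc (Suc t''))"
          using r3 t' t'' by (intro fin[where v = 2 and w = 1]) (auto simp: frame3)
      next
        let ?r = "r''(5 := r'' 9 - r'' 10)"
        define r4 where "r4 = ?r(?r 8 := ?r 1)"
        have r4: "r4 (33 + x) = 1" "r4 8 = 33 + x" "r4 7 = r 7"
          using r3 by (simp_all add: r4_def)
        have frame4: "r4 i = r i" if "i \<notin> {5, 33 + x} \<union> {7..18}" for i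
          using that frame3[OF that] r3 by (auto simp: r4_def)
        have mem4: "(\<lambda>y. r4 (32 + y)) = f(Suc x := 1)"
          using fun_cong[OF mem3] r3 by (auto simp: fun_eq_iff r4_def)
        assume "?r 5 = 0"
        then have "potential k n (f(Suc x := 1)) \<le> potential k n f"
          using avg r3 by simp
        with r4 frame4 mem4 have "wp emit_code Q
            r4 u (Suc (Suc (Suc t'')))"
          using t' t'' by (intro fin[where v = 1 and w = 0]) simp_all
        then show "wp (Op (Store 8 1))
          (wp emit_code Q)
          ?r u (Suc (Suc t''))"
          unfolding r4_def by (rule wp_Store)
      qed
    qed
  qed
qed

text \<open>Loop invariant: exactly the first \<open>x\<close> cells are colored, the output lists
  their colors, \<open>m\<close> numbers remain, and the potential is below
  \<open>b\<close>.\<close>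

lemma wp_choices:
  assumes "env k n r" "r 7 = m" "m > 0" "r 8 = 32 + x" "x + m = n"
    and "potential k n (\<lambda>y. r (32 + y)) < b"
    and "\<And>y. x < y \<Longrightarrow> r (32 + y) = 0"
    and "\<And>y. 0 < y \<Longrightarrow> y \<le> x \<Longrightarrow> r (32 + y) \<in> {1, 2}"
    and "u = map (\<lambda>y. r (32 + y) - 1) [1..<Suc x]"
    and "\<And>f r' t'. potential k n f < b \<Longrightarrow> (\<And>y. 0 < y \<Longrightarrow> y \<le> n \<Longrightarrow> f y \<in> {1, 2}) \<Longrightarrow>
      t' \<le> t + m * (2 * potential_time k n + 16) \<Longrightarrow>
      Q r' (map (\<lambda>y. f y - 1) [1..<Suc n]) t'"
  shows "wp (DoWhile choice_code 7) Q r u t"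
  using assms
proof (induction m arbitrary: r t x u)
  case (Suc m)
  note post = Suc.prems(10)
  show ?case
  proof (rule wp_DoWhile, rule wp_choice)
    show "env k n r" "r 8 = 32 + x" by fact+
    show "r (33 + x) = 0" using Suc.prems(7)[of "Suc x"] by simp
    fix r' w t'
    assume w: "w \<in> {0, 1}" and frame: "\<And>i. i \<notin> {5, 33 + x} \<union> {7..18} \<Longrightarrow> r' i = r i"
      and r': "r' (33 + x) = Suc w" "r' 8 = 33 + x" "r' 7 = r 7 - 1"
      and pot: "potential k n (\<lambda>y. r' (32 + y)) \<le> potential k n (\<lambda>y. r (32 + y))"
      and t': "t' \<le> t + (2 * potential_time k n + 15)"
    have old: "r' (32 + y) = r (32 + y)" if "y \<noteq> Suc x" for y
      using that by (simp add: frame)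
    have new: "r' (32 + Suc x) = Suc w" using r'(1) by simp
    have env': "env k n r'"
      unfolding env_def
    proof (intro conjI allI)
      show "r' (32 + y) \<le> 2" for y
        using old[of y] new w Suc.prems(1) by (cases "y = Suc x") (auto simp: env_def)
    qed (use Suc.prems(1) in \<open>simp_all add: env_def frame\<close>)
    have pot': "potential k n (\<lambda>y. r' (32 + y)) < b" using pot Suc.prems(6) by simp
    have colored: "r' (32 + y) \<in> {1, 2}" if "0 < y" "y \<le> Suc x" for y
      using that old[of y] new w Suc.prems(8)[of y] by (cases "y = Suc x") auto
    have u': "u @ [w] = map (\<lambda>y. r' (32 + y) - 1) [1..<Suc (Suc x)]"
    proof -
      have "map (\<lambda>y. r (32 + y) - 1) [1..<Suc x] = map (\<lambda>y. r' (32 + y) - 1) [1..<Suc x]"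
        by (intro map_cong refl) (auto simp: old)
      then show ?thesis using new unfolding Suc.prems(9) by simp
    qed
    show "if r' 7 = 0 then Q r' (u @ [w]) (Suc t')
      else wp (DoWhile choice_code 7) Q r' (u @ [w]) (Suc t')"
    proof (cases "m = 0")
      case True
      then have n: "n = Suc x" using Suc.prems(5) by simp
      \<comment> \<open>The final memory is the witness for \<open>f\<close>.\<close>
      have "Q r' (map (\<lambda>y. r' (32 + y) - 1) [1..<Suc n]) (Suc t')"
        using pot' by (rule post) (use colored n True t' in auto)
      then show ?thesis using r'(3) Suc.prems(2) True u' n by simp
    next
      case False
      have "wp (DoWhile choice_code 7) Q r' (u @ [w]) (Suc t')"
      proof (rule Suc.IH[OF env' _ _ _ _ pot' _ colored u'])
        fix f r'' t''
        assume "potential k n f < b" "\<And>y. 0 < y \<Longrightarrow> y \<le> n \<Longrightarrow> f y \<in> {1, 2}"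
          "t'' \<le> Suc t' + m * (2 * potential_time k n + 16)"
        then show "Q r'' (map (\<lambda>y. f y - 1) [1..<Suc n]) t''"
          using t' by (intro post) auto
      qed (use False r' Suc.prems old in auto)
      with False r'(3) Suc.prems(2) show ?thesis by simp
    qed
  qed
qed simp

lemma wp_doubling:
  assumes "r 1 = 1" "r 16 = m" "m > 0"
    and "\<And>r' t'. (\<And>i. i \<notin> {2, 16} \<Longrightarrow> r' i = r i) \<Longrightarrow> r' 2 = r 2 * 2 ^ m \<Longrightarrow>
      t' \<le> t + 3 * m \<Longrightarrow> Q r' u t'"
  shows "wp (DoWhile (Op (Add 2 2 2) ;; Op (Sub 16 16 1)) 16) Q r u t" (is "wp ?loop _ _ _ _")
  using assms
proof (induction m arbitrary: r t)
  case (Suc m)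
  define r1 where "r1 = r(2 := 2 * r 2, 16 := m)"
  have "if r1 16 = 0 then Q r1 u (Suc (Suc (Suc t))) else wp ?loop Q r1 u (Suc (Suc (Suc t)))"
  proof (cases "m = 0")
    case True
    then show ?thesis by (auto intro!: Suc.prems(4) simp: r1_def split: if_splits)
  next
    case False
    have "wp ?loop Q r1 u (Suc (Suc (Suc t)))"
    proof (rule Suc.IH)
      fix r' t'
      assume "\<And>i. i \<notin> {2, 16} \<Longrightarrow> r' i = r1 i" "r' 2 = r1 2 * 2 ^ m" "t' \<le> Suc (Suc (Suc t)) + 3 * m"
      then show "Q r' u t'" by (intro Suc.prems(4)) (auto simp: r1_def)
    qed (use False Suc.prems in \<open>auto simp: r1_def\<close>)
    with False show ?thesis by (simp add: r1_def)
  qed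
  moreover have "r(2 := r 2 + r 2, 16 := (r(2 := r 2 + r 2)) 16 - (r(2 := r 2 + r 2)) 1) = r1"
    using Suc.prems by (auto simp: r1_def)
  ultimately show ?case
    by (intro wp_DoWhile wp_Seq wp_Add wp_Sub) (simp del: One_nat_def)
qed simp

text \<open>Squares arise by addition, as \<open>v^2 + v + (v + 1) = (v + 1)^2\<close>. The search
  stops at \<open>n\<close>, here the least number that fails the test.\<close>

lemma wp_square:
  assumes "r 1 = 1" "r 3 = v" "r 4 = v\<^sup>2" "r 2 = b" "v + m = n" "m > 0"
    and below: "\<And>j. 2 * j\<^sup>2 < b \<longleftrightarrow> j < n"
    and "\<And>r' t'. (\<And>i. i \<notin> {3, 4, 5} \<Longrightarrow> r' i = r i) \<Longrightarrow> r' 3 = n \<Longrightarrow>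
      t' \<le> t + 6 * m \<Longrightarrow> Q r' u t'"
  shows "wp (DoWhile square_code 5) Q r u t"
  using assms
proof (induction m arbitrary: r t v)
  case (Suc m)
  define r1 where "r1 = r(3 := Suc v, 4 := (Suc v)\<^sup>2, 5 := b - 2 * (Suc v)\<^sup>2)"
  \<comment> \<open>Register 5 vanishes when \<open>Suc v\<close> fails the test, that is, on
    reaching \<open>n\<close>.\<close>
  have zero: "r1 5 = 0 \<longleftrightarrow> m = 0"
    using below[of "Suc v"] Suc.prems(5) by (auto simp: r1_def)
  have "if r1 5 = 0 then Q r1 u (Suc (t + 5)) else wp (DoWhile square_code 5) Q r1 u (Suc (t + 5))"
  proof (cases "m = 0")
    case True
    then show ?thesis using Suc.prems(5) zero by (auto intro!: Suc.prems(8) simp: r1_def split: if_splits)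
  next
    case False
    have "wp (DoWhile square_code 5) Q r1 u (Suc (t + 5))"
    proof (rule Suc.IH)
      fix r' t'
      assume "\<And>i. i \<notin> {3, 4, 5} \<Longrightarrow> r' i = r1 i" "r' 3 = n" "t' \<le> Suc (t + 5) + 6 * m"
      then show "Q r' u t'" by (intro Suc.prems(8)) (auto simp: r1_def)
    qed (use False Suc.prems below in \<open>auto simp: r1_def\<close>)
    with False zero show ?thesis by simp
  qed
  moreover have "wp square_code (\<lambda>r' u' t'. r' = r1 \<and> u' = u \<and> t' = t + 5) r u t"
    unfolding square_code_def using Suc.prems
    by (intro wp_Seq wp_Add wp_Sub) (auto simp: r1_def fun_eq_iff power2_eq_square)
  ultimately show ?case
    by (intro wp_DoWhile) (auto elim!: wp_mono)
qed simp

text \<open>Doubling costs \<open>3 * k\<close>, the square search \<open>6 * (n + 1)\<close>, the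
  instructions outside loops 11, and each choice two potentials and 16 more.\<close>

definition coloring_time :: "nat \<Rightarrow> nat \<Rightarrow> nat" where
  "coloring_time k n = 3 * k + 6 * n + 17 + n * (2 * potential_time k n + 16)"

lemma wp_coloring:
  assumes k: "k > 0" and n: "\<And>j. 2 * j\<^sup>2 < k * 2 ^ k \<longleftrightarrow> j \<le> n"
  shows "wp coloring_code
    (\<lambda>r u t. (\<exists>f. potential k n f < 2 ^ k \<and> (\<forall>y. 0 < y \<longrightarrow> y \<le> n \<longrightarrow> f y \<in> {1, 2}) \<and>
        u = map (\<lambda>y. f y - 1) [1..<Suc n]) \<and> t \<le> coloring_time k n)
    ((\<lambda>_. 0)(0 := k)) [] 0" (is "wp _ ?Q _ _ _")
proof -
  let ?r0 = "(\<lambda>_::nat. 0)(0 := k, 1 := 1, 20 := 2, 19 := 32, 2 := k, 16 := k)"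
  have fin: "wp greedy_code ?Q r [] t"
    if frame: "\<And>i. i \<notin> {2, 3, 4, 5, 16} \<Longrightarrow> r i = ?r0 i" and "r 3 = Suc n" and "t \<le> 11 + 3 * k + 6 * n" for r t
  proof -
    define r1 where "r1 = r(3 := n, 6 := n + 32, 7 := n, 8 := 32, 5 := 1 - n)"
    have cells: "r1 (32 + y) = 0" for y by (simp add: r1_def frame)
    \<comment> \<open>Nothing is colored, and the potential is an empty sum.\<close>
    have "?Q r1 [] (Suc (Suc (Suc (Suc (Suc (Suc t))))))" if "n = 0"
      using that \<open>t \<le> _\<close> by (auto simp: potential_def coloring_time_def)
    moreover have "wp (DoWhile choice_code 7) ?Q r1 [] (Suc (Suc (Suc (Suc (Suc (Suc t))))))" if "n > 0"
    proof (rule wp_choices[where x = 0 and m = n and b = "2 ^ k" and n = n and k = k])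
      show "env k n r1"
        using k that cells by (simp add: env_def) (simp add: r1_def frame)
      show "potential k n (\<lambda>y. r1 (32 + y)) < 2 ^ k"
        using potential_zero_less[of n k] n[of n] k by (simp add: cells)
      fix f :: "nat \<Rightarrow> nat" and r' t'
      assume "potential k n f < 2 ^ k" "\<And>y. 0 < y \<Longrightarrow> y \<le> n \<Longrightarrow> f y \<in> {1, 2}"
        "t' \<le> Suc (Suc (Suc (Suc (Suc (Suc t))))) + n * (2 * potential_time k n + 16)"
      then show "?Q r' (map (\<lambda>y. f y - 1) [1..<Suc n]) t'"
        using \<open>t \<le> _\<close> by (intro conjI exI[of _ f]) (auto simp: coloring_time_def)
    qed (use that cells in \<open>simp_all add: r1_def\<close>)
    ultimately have "wp (Unless 5 (DoWhile choice_code 7)) ?Q r1 [] (Suc (Suc (Suc (Suc (Suc t)))))"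
      by (intro wp_Unless) (auto simp: r1_def split: if_splits)
    moreover have "r 1 = 1" "r 19 = 32" "r 21 = 0" by (simp_all add: frame)
    ultimately show ?thesis
      unfolding greedy_code_def using \<open>r 3 = Suc n\<close>
      by (intro wp_Seq wp_Sub wp_Add) (simp add: r1_def)
  qed
  have loops: "wp (DoWhile (Op (Add 2 2 2) ;; Op (Sub 16 16 1)) 16)
    (wp (DoWhile square_code 5 ;; greedy_code) ?Q) ?r0 [] (Suc (Suc (Suc (Suc (Suc 0)))))"
  proof (rule wp_doubling[where m = k])
    fix r' t'
    assume frame: "\<And>i. i \<notin> {2, 16} \<Longrightarrow> r' i = ?r0 i" and r': "r' 2 = ?r0 2 * 2 ^ k"
      and t': "t' \<le> Suc (Suc (Suc (Suc (Suc 0)))) + 3 * k"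
    show "wp (DoWhile square_code 5 ;; greedy_code) ?Q r' [] t'"
    \<comment> \<open>The first failing number is \<open>Suc n\<close>, reached from 0 in
      \<open>Suc n\<close> passes.\<close>
    proof (rule wp_Seq, rule wp_square[where v = 0 and m = "Suc n" and n = "Suc n" and b = "k * 2 ^ k"])
      show "2 * j\<^sup>2 < k * 2 ^ k \<longleftrightarrow> j < Suc n" for j using n[of j] by auto
      fix r'' t''
      assume frame': "\<And>i. i \<notin> {3, 4, 5} \<Longrightarrow> r'' i = r' i" and "r'' 3 = Suc n"
        and "t'' \<le> t' + 6 * Suc n"
      then show "wp greedy_code ?Q r'' [] t''"
        using t' by (intro fin) (auto simp: frame' frame)
    qed (use r' in \<open>simp_all add: frame\<close>)
  qed (use k in simp_all)
  show ?thesis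
    unfolding coloring_code_def
    apply (rule wp_Seq wp_Const wp_Add)+
    using loops by (simp del: One_nat_def upt_Suc)
qed

section \<open>The polynomial time bound and the conclusion\<close>

text \<open>Besides \<open>n <= b\<close>, the bound \<open>b\<close> satisfies
  \<open>b^2 = k * 2^(k-1) >= k\<close>. Substituting both in the time and expanding gives the
  coefficients.\<close>

lemma coloring_time_le:
  assumes "k > 0"
  shows "real (coloring_time k (coloring_length k)) \<le>
    poly [:17, 22, 9, 22, 0, 26:] (vdW_bound k)"
proof -
  define b where "b = vdW_bound k"
  define n where "n = coloring_length k"
  have n: "real n \<le> b"
    using le_coloring_length_iff[OF assms, of n] by (simp add: n_def b_def)
  obtain j where j: "k = Suc j" using assms by (cases k) auto
  have "real k * 2 \<le> real k * 2 ^ k"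
    unfolding j by (intro mult_left_mono) simp_all
  then have k: "real k \<le> b\<^sup>2"
    using vdW_bound_square[of k] by (simp add: b_def)
  have b: "0 \<le> b" by (simp add: b_def vdW_bound_nonneg)
  have "real (coloring_time k n) = 3 * real k + 6 * real n + 17 +
      real n * (2 * (real n * (real n * (13 * real k + 11) + 3)) + 16)"
    by (simp add: coloring_time_def)
  also have "\<dots> \<le> 3 * b\<^sup>2 + 6 * b + 17 + b * (2 * (b * (b * (13 * b\<^sup>2 + 11) + 3)) + 16)"
    using n k b by (intro add_mono mult_mono order_refl) auto
  also have "\<dots> = poly [:17, 22, 9, 22, 0, 26:] b"
    by (simp add: algebra_simps power2_eq_square)
  finally show ?thesis by (simp add: b_def n_def)
qed

lemma coloring_code_correct:
  assumes k: "k > 0"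
  shows "\<exists>ys t. outputs_within (compile coloring_code 0) k ys t \<and>
    real t \<le> poly [:17, 22, 9, 22, 0, 26:] (vdW_bound k) \<and>
    length ys = coloring_length k \<and>
    proper_coloring k (coloring_length k) (coloring_of_list ys)"
proof -
  define n where "n = coloring_length k"
  have n: "2 * j\<^sup>2 < k * 2 ^ k \<longleftrightarrow> j \<le> n" for j
    using le_coloring_length_iff[OF k, of j] less_vdW_bound_iff[of j k] by (simp add: n_def)
  obtain ys t f where out: "outputs_within (compile coloring_code 0) k ys t"
    and t: "t \<le> coloring_time k n"
    and f: "potential k n f < 2 ^ k" "\<And>y. 0 < y \<Longrightarrow> y \<le> n \<Longrightarrow> f y \<in> {1, 2}"
    and ys: "ys = map (\<lambda>y. f y - 1) [1..<Suc n]"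
    using wp_outputs_within[OF wp_coloring[OF k n]] by blast
  have "real t \<le> poly [:17, 22, 9, 22, 0, 26:] (vdW_bound k)"
    using coloring_time_le[OF k] t unfolding n_def by (meson of_nat_mono order_trans)
  moreover have "proper_coloring k n (coloring_of_list ys)"
    using f
  proof (rule proper_coloring_of_potential)
    show "coloring_of_list ys y = f y - 1" if "0 < y" "y \<le> n" for y
      using that nth_upt[of 1 "y - 1" "Suc n"] by (simp add: coloring_of_list_def ys del: upt_Suc)
    \<comment> \<open>For \<open>k = 1\<close> already \<open>j = 1\<close> fails the strict test
      \<open>2 < 2\<close>.\<close>
    show "n = 0" if "k = 1" using n[of 1] that by auto
  qed (use k in simp_all)
  moreover have "length ys = n" by (simp add: ys)
  ultimately show ?thesis using out unfolding n_def by blast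
qed

theorem theorem3p1:
  "(\<exists>(P :: instr list) (p :: real poly). \<forall>k>0. \<exists>ys t.
      outputs_within P k ys t \<and> real t \<le> poly p (vdW_bound k) \<and>
      length ys = coloring_length k \<and>
      proper_coloring k (coloring_length k) (coloring_of_list ys))
   \<and> (\<forall>k>0. ereal (vdW_bound k) \<le> ereal_of_enat (vdW k))"
proof (intro conjI allI impI)
  show "\<exists>(P :: instr list) (p :: real poly). \<forall>k>0. \<exists>ys t.
      outputs_within P k ys t \<and> real t \<le> poly p (vdW_bound k) \<and>
      length ys = coloring_length k \<and>
      proper_coloring k (coloring_length k) (coloring_of_list ys)"
    using coloring_code_correct by blast
  fix k :: nat
  assume k: "k > 0"
  obtain g where g: "proper_coloring k (coloring_length k) g"
    using coloring_code_correct[OF k] by blast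
  define S where "S = {W. \<forall>f\<in>two_colorings W.
    \<exists>A. is_AP k A \<and> A \<subseteq> {1..W} \<and> monochromatic f A}"
  \<comment> \<open>A \<open>W\<close> below the bound is at most \<open>coloring_length k\<close>,
    so \<open>g\<close> restricts to a proper coloring of its interval.\<close>
  have bound: "vdW_bound k \<le> real W" if "W \<in> S" for W
  proof (rule ccontr)
    assume "\<not> vdW_bound k \<le> real W"
    then have "{1..W} \<subseteq> {1..coloring_length k}"
      using le_coloring_length_iff[OF k, of W] by auto
    moreover from this g have "g \<in> two_colorings W"
      unfolding proper_coloring_def two_colorings_def by blast
    ultimately show False
      using that g unfolding S_def proper_coloring_def by blast
  qed
  show "ereal (vdW_bound k) \<le> ereal_of_enat (vdW k)"
  proof (cases "S = {}")
    \<comment> \<open>The infimum of the empty set is infinite, so the inequality is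
      trivial.\<close>
    case True
    then have "vdW k = \<infinity>"
      unfolding vdW_def S_def[symmetric] by (simp add: top_enat_def)
    then show ?thesis by simp
  next
    case False
    then have "Inf (enat ` S) \<in> enat ` S"
      by (metis Inf_enat_def LeastI_ex all_not_in_conv image_is_empty)
    then obtain W where "W \<in> S" "vdW k = enat W"
      unfolding vdW_def S_def[symmetric] by auto
    with bound show ?thesis by simp
  qed
qed

end
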